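(* For every real number $c > 0$, the set $$M_c = \{y\in\mathbb{N} : \exists k\in\mathbb{N} \text{ such that } T^k(y) < cy\}$$ has density $1$.
   Context: $\mathbb{N}=\{0,1,2,\dots\}$. The Collatz map $T\colon\mathbb{N}\to\mathbb{N}$ is defined by $T(n)=n/2$ if $n$ is even and $T(n)=(3n+1)/2$ if $n$ is odd; $T^k$ denotes the $k$-th iterate of $T$ ($T^0$ is the identity). For $A\subset\mathbb{N}$, the upper density is $\overline{d}(A)=\limsup_{n\to\infty}|A\cap[0,n]|/n$ and the lower density is $\underline{d}(A)=\liminf_{n\to\infty}|A\cap[0,n]|/n$; if they are equal, $A$ has density $d(A)=\overline{d}(A)=\underline{d}(A)$. *)

theory Defs
  imports Complex_Main "HOL-Library.Extended_Real"
begin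

text \<open>In both branches the natural-number division is exact.\<close>

definition collatz :: "nat \<Rightarrow> nat" where
  "collatz n = (if even n then n div 2 else (3 * n + 1) div 2)"

text \<open>The quotient at \<open>n = 0\<close> is \<open>0\<close> by the convention \<open>x / 0 = 0\<close>; this single term
  does not affect the limits.\<close>

definition upper_density :: "nat set \<Rightarrow> ereal" where
  "upper_density A = limsup (\<lambda>n. ereal (real (card (A \<inter> {0..n})) / real n))"

definition lower_density :: "nat set \<Rightarrow> ereal" where
  "lower_density A = liminf (\<lambda>n. ereal (real (card (A \<inter> {0..n})) / real n))"

definition has_density :: "nat set \<Rightarrow> real \<Rightarrow> bool" where
  "has_density A d \<longleftrightarrow> upper_density A = ereal d \<and> lower_density A = ereal d"

end

theory Submission
  imports Defs
begin

text \<open>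
  If \<open>j\<close> of the first \<open>k\<close> iterates of \<open>y\<close> are odd, then \<open>T\<^sup>k(y) = (3\<^sup>j / 2\<^sup>k) y + O\<^sub>k(1)\<close>, where both
  \<open>j\<close> and the error depend only on \<open>y\<close> modulo \<open>2\<^sup>k\<close>. Every parity vector of length \<open>k\<close> comes from
  exactly one residue, so the average of \<open>(3\<^sup>j / 2\<^sup>k) powr (1/2)\<close> over all residues is
  \<open>((1 + sqrt 3) / (2 * sqrt 2))\<^sup>k\<close>. The base is less than \<open>1\<close> because \<open>sqrt 3 < 2\<close>, so by
  Markov's inequality the residues with \<open>3\<^sup>j / 2\<^sup>k \<ge> c / 2\<close> have density tending to \<open>0\<close>.
\<close>

definition odd_steps :: "nat \<Rightarrow> nat \<Rightarrow> nat" where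
  "odd_steps k n = (\<Sum>i<k. (collatz ^^ i) n mod 2)"

lemma odd_steps_0 [simp]: "odd_steps 0 n = 0"
  by (simp add: odd_steps_def)

lemma odd_steps_Suc: "odd_steps (Suc k) n = odd_steps k n + (collatz ^^ k) n mod 2"
  by (simp add: odd_steps_def)

text \<open>An even offset preserves parity, so the same branch applies to both arguments; the
  offset is halved, and also tripled if \<open>x\<close> is odd.\<close>

lemma collatz_add_even: "collatz (2 * b + x) = 3 ^ (x mod 2) * b + collatz x"
proof (cases "even x")
  case False
  then obtain y where "x = 2 * y + 1"
    by (rule oddE)
  then have "3 * (2 * b + x) + 1 = 2 * (3 * b + 3 * y + 2)" "3 * x + 1 = 2 * (3 * y + 2)"
    by simp_all
  with False show ?thesis
    by (simp add: collatz_def mod_2_eq_odd del: mult_Suc_right)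
qed (auto simp: collatz_def mod_2_eq_odd elim!: evenE)

text \<open>The two claims go together: the offset of the iterates stays even before step
  \<open>k\<close>, which keeps the parities equal. The induction step uses the hypothesis at
  \<open>2 * a\<close>, hence the arbitrary \<open>a\<close>.\<close>

lemma odd_steps_collatz_shift:
  "odd_steps k (2 ^ k * a + r) = odd_steps k r \<and>
   (collatz ^^ k) (2 ^ k * a + r) = 3 ^ odd_steps k r * a + (collatz ^^ k) r"
proof (induction k arbitrary: a)
  case (Suc k)
  have IH: "odd_steps k (2 ^ Suc k * a + r) = odd_steps k r"
    "(collatz ^^ k) (2 ^ Suc k * a + r) = 2 * (3 ^ odd_steps k r * a) + (collatz ^^ k) r"
    using Suc[of "2 * a"] by (simp_all add: ac_simps)
  show ?case
    by (simp add: odd_steps_Suc IH collatz_add_even power_add del: power_Suc)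
qed simp

lemmas odd_steps_shift = odd_steps_collatz_shift[THEN conjunct1]
  and collatz_shift = odd_steps_collatz_shift[THEN conjunct2]

lemma sum_lessThan_double:
  fixes f :: "nat \<Rightarrow> 'a::comm_monoid_add"
  shows "(\<Sum>r<2 * m. f r) = (\<Sum>r<m. f r + f (m + r))"
proof -
  have "(\<Sum>r<2 * m. f r) = (\<Sum>r<m. f r) + (\<Sum>r=m..<m + m. f r)"
    by (simp add: lessThan_atLeast0 sum.atLeastLessThan_concat mult_2)
  also have "(\<Sum>r=m..<m + m. f r) = (\<Sum>r<m. f (m + r))"
    using sum.shift_bounds_nat_ivl[of f 0 m m] by (simp add: lessThan_atLeast0 add.commute)
  finally show ?thesis
    by (simp add: sum.distrib)
qed

text \<open>The iterates \<open>T\<^sup>k(r)\<close> and \<open>T\<^sup>k(2\<^sup>k + r)\<close> differ by a power of \<open>3\<close>, so exactly one of them is odd.\<close>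

lemma sum_power_odd_steps:
  fixes s :: "'a::comm_semiring_1"
  shows "(\<Sum>r<2 ^ k. s ^ odd_steps k r) = (1 + s) ^ k"
proof (induction k)
  case (Suc k)
  have "s ^ odd_steps (Suc k) r + s ^ odd_steps (Suc k) (2 ^ k + r) = (1 + s) * s ^ odd_steps k r"
    for r
  proof -
    have "odd_steps k (2 ^ k + r) = odd_steps k r"
      "(collatz ^^ k) (2 ^ k + r) = 3 ^ odd_steps k r + (collatz ^^ k) r"
      using odd_steps_shift[of k 1 r] collatz_shift[of k 1 r] by simp_all
    then show ?thesis
      by (cases "even ((collatz ^^ k) r)")
        (simp_all add: odd_steps_Suc mod_2_eq_odd power_add algebra_simps)
  qed
  then show ?case
    by (simp add: sum_lessThan_double Suc flip: sum_distrib_left)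
qed simp

text \<open>Markov's inequality for the square root of \<open>3 ^ odd_steps k r\<close>. The first
  moment would not do: its average over the residues is \<open>(1 + 3) ^ k / 2 ^ k\<close>, exactly
  \<open>2 ^ k\<close>, which gives no decay in \<open>k\<close>.\<close>

lemma card_large_odd_steps_le:
  fixes d :: real
  assumes "d > 0"
  shows "real (card {r \<in> {..<2 ^ k}. d * 2 ^ k \<le> 3 ^ odd_steps k r}) / 2 ^ k
    \<le> ((1 + sqrt 3) / (2 * sqrt 2)) ^ k / sqrt d"
proof -
  let ?R = "{r \<in> {..<2 ^ k}. d * 2 ^ k \<le> (3::real) ^ odd_steps k r}"
  have "real (card ?R) * (sqrt d * sqrt 2 ^ k) = (\<Sum>r\<in>?R. sqrt (d * 2 ^ k))"
    by (simp add: real_sqrt_mult real_sqrt_power)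
  also have "\<dots> \<le> (\<Sum>r\<in>?R. sqrt 3 ^ odd_steps k r)"
    by (intro sum_mono) (auto simp flip: real_sqrt_power)
  also have "\<dots> \<le> (\<Sum>r<2 ^ k. sqrt 3 ^ odd_steps k r)"
    by (intro sum_mono2) auto
  also have "\<dots> = (1 + sqrt 3) ^ k"
    by (rule sum_power_odd_steps)
  finally show ?thesis
    using assms by (simp add: field_simps power_mult_distrib power_divide)
qed

lemma one_plus_sqrt3_less: "(1 + sqrt 3) / (2 * sqrt 2) < 1"
proof -
  have "sqrt 3 < sqrt 4"
    by (rule real_sqrt_less_mono) simp
  \<comment> \<open>The squares are \<open>4 + 2 * sqrt 3\<close> and \<open>8\<close>.\<close>
  then have "(1 + sqrt 3)\<^sup>2 < (2 * sqrt 2)\<^sup>2"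
    by (simp add: power2_sum power_mult_distrib)
  then have "1 + sqrt 3 < 2 * sqrt 2"
    by (rule power_less_imp_less_base) simp
  then show ?thesis
    by simp
qed

text \<open>Remainder and quotient determine \<open>y\<close>, and the quotient takes at most
  \<open>n div m + 1\<close> values.\<close>

lemma card_mod_in_le:
  fixes m n :: nat
  assumes "finite R"
  shows "card {y \<in> {0..n}. y mod m \<in> R} \<le> card R * (n div m + 1)"
proof -
  have "card {y \<in> {0..n}. y mod m \<in> R} \<le> card (R \<times> {..n div m})"
  proof (rule card_inj_on_le)
    show "inj_on (\<lambda>y. (y mod m, y div m)) {y \<in> {0..n}. y mod m \<in> R}"
      by (rule inj_onI) (metis Pair_inject div_mult_mod_eq)
  qed (use assms in \<open>auto intro: div_le_mono\<close>)
  then show ?thesis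
    by (simp add: card_cartesian_product)
qed

text \<open>The constant \<open>C\<close> may depend on \<open>e\<close>, since it vanishes after
  division by \<open>n\<close>; it absorbs finitely many exceptions.\<close>

lemma has_density_1I:
  assumes "\<And>e. e > 0 \<Longrightarrow> \<exists>C. \<forall>n. real (card ({0..n} - A)) \<le> C + e * real n"
  shows "has_density A 1"
proof -
  let ?f = "\<lambda>n. real (card (A \<inter> {0..n})) / real n"
  have card_eq: "real (card (A \<inter> {0..n})) = 1 + real n - real (card ({0..n} - A))" for n
    using card_Int_Diff[of "{0..n}" A] by (simp add: Int_commute)
  have "?f \<longlonglongrightarrow> 1"
  proof (rule LIMSEQ_I)
    fix e :: real
    assume e: "e > 0"
    then obtain C where C: "\<And>n. real (card ({0..n} - A)) \<le> C + e / 2 * real n"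
      using assms[of "e / 2"] by auto
    obtain N :: nat where N: "real N > (2 * (1 + \<bar>C\<bar>)) / e"
      using reals_Archimedean2 by blast
    show "\<exists>N. \<forall>n\<ge>N. norm (?f n - 1) < e"
    proof (intro exI allI impI)
      fix n :: nat
      \<comment> \<open>The successor makes \<open>n\<close> visibly positive, so the division by
        \<open>n\<close> is genuine.\<close>
      assume "n \<ge> Suc N"
      then have n: "real n > 0" "real n > (2 * (1 + \<bar>C\<bar>)) / e"
        using N by linarith+
      then have "e / 2 * real n > 1 + \<bar>C\<bar>"
        using e by (simp add: field_simps)
      \<comment> \<open>The \<open>1\<close> is the surplus of \<open>{0..n}\<close>, which has
        \<open>n + 1\<close> elements. It must also be below \<open>e * real n\<close>, in case the
        complement is empty; hence \<open>1 + \<bar>C\<bar>\<close> in the choice of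
        \<open>N\<close>.\<close>
      then have "\<bar>1 - real (card ({0..n} - A))\<bar> < e * real n"
        using C[of n] by simp
      moreover have "?f n - 1 = (1 - real (card ({0..n} - A))) / real n"
        using n unfolding card_eq by (simp add: field_simps)
      ultimately show "norm (?f n - 1) < e"
        using n by (simp add: field_simps)
    qed
  qed
  then have lim: "(\<lambda>n. ereal (?f n)) \<longlonglongrightarrow> ereal 1"
    by (rule tendsto_ereal)
  show ?thesis
    unfolding has_density_def upper_density_def lower_density_def
    using lim_imp_Limsup[OF _ lim] lim_imp_Liminf[OF _ lim] by simp
qed

theorem corollary3p3:
  fixes c :: real
  assumes "c > 0"
  shows "has_density {y :: nat. \<exists>k :: nat. real ((collatz ^^ k) y) < c * real y} 1"
  (is "has_density ?M 1")
proof (rule has_density_1I)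
  fix e :: real
  assume "e > 0"
  have "(\<lambda>k. ((1 + sqrt 3) / (2 * sqrt 2)) ^ k / sqrt (c / 2)) \<longlonglongrightarrow> 0 / sqrt (c / 2)"
    using one_plus_sqrt3_less assms
    by (intro tendsto_divide LIMSEQ_realpow_zero tendsto_const) auto
  then have "\<forall>\<^sub>F k in sequentially. ((1 + sqrt 3) / (2 * sqrt 2)) ^ k / sqrt (c / 2) < e"
    using \<open>e > 0\<close> by (intro order_tendstoD(2)) auto
  then obtain k where k: "((1 + sqrt 3) / (2 * sqrt 2)) ^ k / sqrt (c / 2) < e"
    by (auto simp: eventually_sequentially)
  \<comment> \<open>The bad residues. The threshold is \<open>c / 2\<close> because the other half
    of \<open>c\<close> is kept for the additive error, bounded by \<open>D\<close> and dominated
    once \<open>y > L\<close>.\<close>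
  define R where "R = {r \<in> {..<2 ^ k}. c / 2 * 2 ^ k \<le> (3::real) ^ odd_steps k r}"
  define D where "D = Max ((collatz ^^ k) ` {..<2 ^ k})"
  define L where "L = nat \<lceil>2 * D / c\<rceil>"
  have R: "finite R" "real (card R) / 2 ^ k \<le> e"
    using card_large_odd_steps_le[of "c / 2" k] k assms by (auto simp: R_def)
  have mem: "y \<in> ?M" if "y > L" "y mod 2 ^ k \<notin> R" for y
  proof -
    define a r where "a = y div 2 ^ k" and "r = y mod 2 ^ k"
    have y: "y = 2 ^ k * a + r" and r: "r < 2 ^ k"
      by (simp_all add: a_def r_def)
    have "(collatz ^^ k) r \<le> D"
      unfolding D_def using r by (intro Max_ge) auto
    moreover have "3 ^ odd_steps k r * real a \<le> c / 2 * 2 ^ k * real a"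
      using that(2) r by (intro mult_right_mono) (auto simp: R_def r_def)
    ultimately have "real ((collatz ^^ k) y) \<le> c / 2 * 2 ^ k * real a + D"
      unfolding y collatz_shift by simp
    also have "c / 2 * 2 ^ k * real a \<le> c / 2 * real y"
      using assms by (simp add: y)
    also have "2 * D / c < real y"
      using that(1) by (simp add: L_def) linarith
    then have "D < c / 2 * real y"
      using assms by (simp add: field_simps)
    finally show ?thesis
      by auto
  qed
  show "\<exists>C. \<forall>n. real (card ({0..n} - ?M)) \<le> C + e * real n"
  proof (intro exI allI)
    fix n
    \<comment> \<open>Only small numbers and bad residue classes can fail; \<open>L\<close> and
      \<open>R\<close> are independent of \<open>n\<close>.\<close>
    have "{0..n} - ?M \<subseteq> {0..L} \<union> {y \<in> {0..n}. y mod 2 ^ k \<in> R}"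
      using mem
      by (intro subsetI)
        (metis (no_types, lifting) DiffE UnCI atLeastAtMost_iff le0 mem_Collect_eq not_le)
    then have "card ({0..n} - ?M) \<le> card ({0..L} \<union> {y \<in> {0..n}. y mod 2 ^ k \<in> R})"
      by (intro card_mono) auto
    also have "\<dots> \<le> (L + 1) + card R * (n div 2 ^ k + 1)"
      using card_Un_le[of "{0..L}" "{y \<in> {0..n}. y mod 2 ^ k \<in> R}"]
        card_mod_in_le[OF R(1), of n "2 ^ k"] by simp
    finally have "real (card ({0..n} - ?M)) \<le> real ((L + 1) + card R * (n div 2 ^ k + 1))"
      by (rule of_nat_mono)
    also have "\<dots> = real (L + 1 + card R) + real (card R) * real (n div 2 ^ k)"
      by (simp add: algebra_simps)
    also have "real (card R) * real (n div 2 ^ k) \<le> real (card R) * (real n / 2 ^ k)"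
      using of_nat_div_le_of_nat[of n "2 ^ k", where 'a = real] by (intro mult_left_mono) auto
    also have "\<dots> = real (card R) / 2 ^ k * real n"
      by simp
    also have "\<dots> \<le> e * real n"
      using R(2) by (intro mult_right_mono) auto
    finally show "real (card ({0..n} - ?M)) \<le> real (L + 1 + card R) + e * real n"
      by simp
  qed
qed

end
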